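(* Let $k \ge 2$ and $s \ge 1$ be integers and let $D$ be a $k$-partite tournament with $k$-partition $(V_1,V_2,\ldots,V_k)$ and ordered strong components $Q_1, Q_2, \ldots, Q_s$. If $Q_s$ is nontrivial, then the graph sequence $\{C^m(D)\}_{m=1}^{\infty}$ converges to a graph $G$ such that \[ G \cong \begin{cases} K_{|V(D)|}, & \text{if } \kappa(Q_s)=1;\\ \text{a graph of the form } G_1, & \text{if } \kappa(Q_s)=2;\\ \text{a graph of the form } G_3, & \text{if } \kappa(Q_s)=3;\\ \text{a graph of the form } G_2, & \text{if } \kappa(Q_s)=4, \end{cases} \] and one of these four cases always occurs (that is, $\kappa(Q_s)\in\{1,2,3,4\}$).
   Context: All digraphs are finite and have a simple underlying graph (no loops, no multiple arcs, no pair of opposite arcs). A $k$-partite tournament is an orientation of a complete $k$-partite graph (with $k$ nonempty partite sets, forming its $k$-partition). $m$-step competition graph: for a positive integer $m$, $C^m(D)$ is the simple graph with vertex set $V(D)$ in which two distinct vertices $u,v$ are adjacent if and only if there is a vertex $z$ such that $D$ has a directed walk of length $m$ from $u$ to $z$ and a directed walk of length $m$ from $v$ to $z$. The sequence $\{C^m(D)\}_{m\ge1}$ converges to $G$ (its limit) if $C^m(D)=G$ for all sufficiently large $m$. Ordered strong components: the strong components of $D$ listed as $Q_1,\ldots,Q_s$ so that there is no arc from $Q_i$ to $Q_j$ whenever $i>j$. A strong component is trivial if it has exactly one vertex, and nontrivial otherwise. For a strongly connected nontrivial digraph $Q$, the index of imprimitivity $\kappa(Q)$ is the greatest common divisor of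 the lengths of the closed directed walks of $Q$. Graphs of the form $G_1,G_2,G_3$: the vertex set is partitioned into sets $W_1,\dots,W_r$, each of which is allowed to be empty (then one says that $K^{(i)}$ "does not exist"). Each $W_i$ induces a clique $K^{(i)}$. For $i\ne j$, either all edges between $W_i$ and $W_j$ are present ("$i$ and $j$ are joined") or none are. The joined pairs $\{i,j\}$ are exactly the following. - $G_1$ ($r=3$): $\{1,2\},\{1,3\}$. - $G_2$ ($r=7$): $\{1,i\}$ for $2\le i\le 7$; $\{2,4\},\{2,5\},\{3,6\},\{3,7\}$. - $G_3$ ($r=7$): $\{1,i\}$ for $2\le i\le 7$; $\{2,3\},\{2,4\},\{3,4\}$; $\{2,5\},\{2,6\}$; $\{3,5\},\{3,7\}$; $\{4,6\},\{4,7\}$. *)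

theory Defs
  imports "Graph_Theory.Graph_Theory" "HOL-Library.Disjoint_Sets"
begin

text \<open>
  Simple graphs are represented, as in \<^theory>\<open>Graph_Theory.Digraph\<close>, by symmetric loop-free
  digraphs (locale \<^locale>\<open>graph\<close>).
\<close>

text \<open>
  For \<open>i \<noteq> j\<close> the condition \<open>\<noteq>\<close> between truth values says that exactly one of the two
  arcs is present; this also excludes opposite arcs.
\<close>
definition partite_tournament :: "nat \<Rightarrow> (nat \<Rightarrow> 'a set) \<Rightarrow> ('a, 'b) pre_digraph \<Rightarrow> bool" where
  "partite_tournament k V D \<longleftrightarrow>
     digraph D \<and>
     (\<forall>i\<in>{1..k}. V i \<noteq> {}) \<and>
     disjoint_family_on V {1..k} \<and>
     (\<Union>i\<in>{1..k}. V i) = verts D \<and>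
     (\<forall>i\<in>{1..k}. \<forall>u\<in>V i. \<forall>v\<in>V i. \<not> u \<rightarrow>\<^bsub>D\<^esub> v) \<and>
     (\<forall>i\<in>{1..k}. \<forall>j\<in>{1..k}. i \<noteq> j \<longrightarrow>
        (\<forall>u\<in>V i. \<forall>v\<in>V j. (u \<rightarrow>\<^bsub>D\<^esub> v) \<noteq> (v \<rightarrow>\<^bsub>D\<^esub> u)))"

definition step_competition_graph :: "nat \<Rightarrow> ('a, 'b) pre_digraph \<Rightarrow> 'a pair_pre_digraph" where
  "step_competition_graph m D =
     \<lparr> pverts = verts D,
       parcs = {(u, v). u \<in> verts D \<and> v \<in> verts D \<and> u \<noteq> v \<and>
         (\<exists>z p q. pre_digraph.awalk D u p z \<and> length p = m \<and>
                  pre_digraph.awalk D v q z \<and> length q = m)} \<rparr>"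

definition graph_seq_converges :: "(nat \<Rightarrow> 'a pair_pre_digraph) \<Rightarrow> 'a pair_pre_digraph \<Rightarrow> bool" where
  "graph_seq_converges X G \<longleftrightarrow> (\<exists>N. \<forall>m\<ge>N. X m = G)"

definition ordered_strong_components ::
    "nat \<Rightarrow> (nat \<Rightarrow> ('a, 'b) pre_digraph) \<Rightarrow> ('a, 'b) pre_digraph \<Rightarrow> bool" where
  "ordered_strong_components s Q D \<longleftrightarrow>
     bij_betw Q {1..s} (pre_digraph.sccs D) \<and>
     (\<forall>i\<in>{1..s}. \<forall>j\<in>{1..s}. j < i \<longrightarrow>
        (\<forall>u\<in>verts (Q i). \<forall>v\<in>verts (Q j). \<not> u \<rightarrow>\<^bsub>D\<^esub> v))"

definition trivial_component :: "('a, 'b) pre_digraph \<Rightarrow> bool" where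
  "trivial_component Q \<longleftrightarrow> card (verts Q) = 1"

definition imprimitivity_index :: "('a, 'b) pre_digraph \<Rightarrow> nat" where
  "imprimitivity_index Q = Gcd {length p | p u. pre_digraph.awalk Q u p u \<and> p \<noteq> []}"

text \<open>
  \<open>J\<close> is the set of joined pairs \<open>{i, j}\<close> of indices in \<open>{1..r}\<close>. The sets \<open>W i\<close> may be empty.
\<close>
definition clique_partition_form :: "nat \<Rightarrow> nat set set \<Rightarrow> ('a, 'b) pre_digraph \<Rightarrow> bool" where
  "clique_partition_form r J H \<longleftrightarrow>
     graph H \<and>
     (\<exists>W. disjoint_family_on W {1..r} \<and>
          (\<Union>i\<in>{1..r}. W i) = verts H \<and>
          (\<forall>i\<in>{1..r}. complete_digraph (card (W i)) (H \<restriction> W i)) \<and>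
          (\<forall>i\<in>{1..r}. \<forall>j\<in>{1..r}. i \<noteq> j \<longrightarrow>
             (if {i, j} \<in> J then \<forall>u\<in>W i. \<forall>v\<in>W j. u \<rightarrow>\<^bsub>H\<^esub> v
              else \<forall>u\<in>W i. \<forall>v\<in>W j. \<not> u \<rightarrow>\<^bsub>H\<^esub> v)))"

definition form_G1 :: "('a, 'b) pre_digraph \<Rightarrow> bool" where
  "form_G1 = clique_partition_form 3 {{1,2}, {1,3}}"

definition form_G2 :: "('a, 'b) pre_digraph \<Rightarrow> bool" where
  "form_G2 = clique_partition_form 7
     ({{1,i} | i. i \<in> {2..7}} \<union> {{2,4}, {2,5}, {3,6}, {3,7}})"

definition form_G3 :: "('a, 'b) pre_digraph \<Rightarrow> bool" where
  "form_G3 = clique_partition_form 7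
     ({{1,i} | i. i \<in> {2..7}} \<union> {{2,3}, {2,4}, {3,4}} \<union> {{2,5}, {2,6}} \<union>
      {{3,5}, {3,7}} \<union> {{4,6}, {4,7}})"

end

theory Submission
  imports Defs "HOL-Number_Theory.Cong"
begin

text \<open>
  Let \<open>S\<close> be the vertex set of the last strong component and \<open>\<kappa>\<close> its index of imprimitivity. The set
  \<open>S\<close> cannot be left, and it splits into \<open>\<kappa>\<close> cyclic classes such that each arc leads from a class to
  the next one. Conversely, because the lengths of the closed walks at a vertex form an additive set
  with greatest common divisor \<open>\<kappa>\<close>, every sufficiently long walk length that the classes permit
  is realised (lemma \<open>eventually_walk\<close>). So for large \<open>m\<close> the vertices of \<open>S\<close> that a vertex \<open>v\<close>
  reaches in exactly \<open>m\<close> steps form a union of classes, and this union merely rotates as \<open>m\<close> grows.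
  It is recorded, with the rotation undone, by the set \<open>phases v\<close> of residues modulo \<open>\<kappa>\<close>.

  In a multipartite tournament every vertex reaches \<open>S\<close>: the ends of an arc of \<open>S\<close> lie in
  different partite sets, so a vertex outside \<open>S\<close> is adjacent to one of them, necessarily towards
  \<open>S\<close>. A common target of two vertices can therefore be pushed into \<open>S\<close>, and two vertices are
  adjacent in the limit graph exactly when their phase sets meet (\<open>eventually_common_target_iff\<close>).
  Hence the sequence converges to the intersection graph of the nonempty phase sets.

  It remains to see which phase sets occur. Two vertices of \<open>S\<close> are non-adjacent, and so share
  a partite set, unless the class of one cyclically follows the class of the other. If \<open>\<kappa> \<ge> 5\<close>, then
  the classes \<open>2\<close> and \<open>3\<close> would both lie in the partite set of class \<open>0\<close>, although there are arcs
  between them; so \<open>\<kappa> \<le> 4\<close> (\<open>period_le_4\<close>). For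
  \<open>\<kappa> \<le> 3\<close> the forms in question are simply the intersection graphs of all nonempty sets of residues.
  For \<open>\<kappa> = 4\<close> opposite classes share a partite set, so an arc that enters \<open>S\<close> at some class comes
  with an arc from the same vertex to the opposite class. The phase set of a vertex outside \<open>S\<close> is
  then closed under adding \<open>2\<close>, which leaves \<open>{0, 2}\<close>, \<open>{1, 3}\<close> and the full set besides the singletons that
  belong to vertices of \<open>S\<close> (\<open>phases_period_4\<close>).
\<close>

section \<open>Additive sets of natural numbers\<close>

text \<open>
  The least positive difference \<open>d\<close> of two elements of \<open>L\<close> equals the greatest common divisor. With
  \<open>b\<close> and \<open>b + d\<close> in \<open>L\<close> and \<open>b = d t\<close>, every multiple \<open>d (q t + r)\<close> with \<open>r < t\<close> and
  \<open>q \<ge> r\<close> is the combination \<open>(q - r) b + r (b + d)\<close>, which explains the bound \<open>d t\<^sup>2\<close>.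
\<close>

lemma additive_set_eventually_multiples:
  fixes L :: "nat set"
  assumes add: "\<And>a b. a \<in> L \<Longrightarrow> b \<in> L \<Longrightarrow> a + b \<in> L"
    and zero: "0 \<in> L" and pos: "l \<in> L" "l > 0"
  shows "\<exists>N. \<forall>n\<ge>N. Gcd L dvd n \<longrightarrow> n \<in> L"
proof -
  have mult: "n * a \<in> L" if "a \<in> L" for n a
    by (induction n) (auto simp: zero add that)
  define P where "P d \<longleftrightarrow> d > 0 \<and> (\<exists>b\<in>L. b + d \<in> L)" for d
  define d where "d = (LEAST d. P d)"
  have "P l" using pos zero by (auto simp: P_def intro!: bexI[of _ 0])
  then have "P d" unfolding d_def by (rule LeastI)
  then obtain b where b: "b \<in> L" "b + d \<in> L" and d: "d > 0" by (auto simp: P_def)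
  have d_dvd: "d dvd x" if x: "x \<in> L" for x
  proof (rule ccontr)
    assume "\<not> d dvd x"
    then have r: "x mod d > 0" by (simp add: dvd_eq_mod_eq_0)
    define q where "q = x div d"
    \<comment> \<open>The elements \<open>q (b + d)\<close> and \<open>x + q b\<close> of \<open>L\<close> differ by the remainder of \<open>x\<close>.\<close>
    have "q * (b + d) \<in> L" "x + q * b \<in> L" using b x by (auto intro!: add mult)
    moreover have "x + q * b = q * (b + d) + x mod d"
      unfolding q_def by (simp add: algebra_simps)
    ultimately have "P (x mod d)" using r by (metis P_def)
    then have "d \<le> x mod d" unfolding d_def by (rule Least_le)
    moreover have "x mod d < d" using d by simp
    ultimately show False by simp
  qed
  have "Gcd L dvd b" "Gcd L dvd b + d" using b by (auto intro: Gcd_dvd)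
  then have "Gcd L dvd d" by (simp add: dvd_add_right_iff)
  moreover have "d dvd Gcd L" using d_dvd by (auto intro: Gcd_greatest)
  ultimately have gcd: "Gcd L = d" by (simp add: dvd_antisym)
  from d_dvd[OF b(1)] obtain t where t: "b = d * t" by (auto simp: dvd_def)
  have "n \<in> L" if n: "n \<ge> d * (t * t)" and dn: "d dvd n" for n
  proof (cases "t = 0")
    case True
    then have "d \<in> L" using b t by simp
    then show ?thesis using dn mult by (metis dvd_def mult.commute)
  next
    case False
    from dn obtain x where x: "n = d * x" by (auto simp: dvd_def)
    define q r where "q = x div t" and "r = x mod t"
    have xt: "x = q * t + r" by (simp add: q_def r_def)
    have rt: "r < t" using False by (simp add: r_def)
    have "t * t \<le> x" using n x d by simp
    then have "t \<le> q" using False by (simp add: q_def less_eq_div_iff_mult_less_eq)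
    then obtain e where e: "q = r + e" using rt by (metis le_add_diff_inverse less_imp_le less_le_trans)
    have "n = e * b + r * (b + d)"
      unfolding x xt e t by (simp add: algebra_simps)
    then show ?thesis using b by (simp add: add mult)
  qed
  then show ?thesis unfolding gcd by blast
qed


section \<open>Long walks in a closed strongly connected set\<close>

lemma relpow_append:
  "(u, v) \<in> E ^^ a \<Longrightarrow> (v, w) \<in> E ^^ b \<Longrightarrow> (u, w) \<in> E ^^ (a + b)"
  by (auto simp: relpow_add)

locale closed_strong_set =
  fixes E :: "('a \<times> 'a) set" and S :: "'a set"
  assumes finite_S: "finite S" and S_nonempty: "S \<noteq> {}"
    and closed: "(u, v) \<in> E \<Longrightarrow> u \<in> S \<Longrightarrow> v \<in> S"
    and connected: "u \<in> S \<Longrightarrow> v \<in> S \<Longrightarrow> \<exists>m. (u, v) \<in> E ^^ m"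
    and successor: "u \<in> S \<Longrightarrow> \<exists>v. (u, v) \<in> E"
begin

definition period :: nat where
  "period = Gcd {m. 0 < m \<and> (\<exists>u\<in>S. (u, u) \<in> E ^^ m)}"

definition root :: 'a where
  "root = (SOME r. r \<in> S)"

text \<open>
  The class of a vertex of \<open>S\<close> is its level modulo the period. Which walk from the root is chosen
  does not matter modulo the period, by lemma \<open>level_walk_cong\<close>.
\<close>

definition level :: "'a \<Rightarrow> nat" where
  "level v = (SOME m. (root, v) \<in> E ^^ m)"

lemma root_in: "root \<in> S"
  unfolding root_def using S_nonempty by (simp add: some_in_eq)

lemma level_walk: "v \<in> S \<Longrightarrow> (root, v) \<in> E ^^ level v"
  unfolding level_def using connected[OF root_in] by (rule someI_ex)

lemma closed_walk: "(u, v) \<in> E ^^ m \<Longrightarrow> u \<in> S \<Longrightarrow> v \<in> S"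
  by (induction m arbitrary: v) (auto intro: closed)

lemma walk_exists: "u \<in> S \<Longrightarrow> \<exists>v\<in>S. (u, v) \<in> E ^^ m"
proof (induction m)
  case (Suc m)
  then obtain v where "v \<in> S" "(u, v) \<in> E ^^ m" by blast
  moreover from this obtain w where "(v, w) \<in> E" using successor by blast
  ultimately show ?case using closed by auto
qed auto

lemma period_dvd: "u \<in> S \<Longrightarrow> (u, u) \<in> E ^^ m \<Longrightarrow> period dvd m"
  unfolding period_def by (cases "m = 0") (auto intro: Gcd_dvd)

lemma positive_closed_walk:
  assumes "u \<in> S"
  obtains m where "m > 0" "(u, u) \<in> E ^^ m"
proof -
  obtain v where v: "(u, v) \<in> E" "v \<in> S" using successor closed assms by blast
  then obtain n where "(v, u) \<in> E ^^ n" using connected assms by blast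
  then have "(u, u) \<in> E ^^ Suc n" using v by (meson relpow_Suc_I2)
  then show ?thesis using that by blast
qed

lemma period_pos: "period > 0"
proof -
  obtain m where "m > 0" "(root, root) \<in> E ^^ m" using positive_closed_walk root_in by blast
  then show ?thesis using period_dvd[OF root_in] by (metis dvd_0_left_iff gr0I less_irrefl)
qed

text \<open>
  Completing the walk to the root on either side, through one and the same return walk, gives two closed
  walks at the root, whose lengths are multiples of the period.
\<close>

lemma level_walk_cong:
  assumes "u \<in> S" "(u, v) \<in> E ^^ m"
  shows "[level v = level u + m] (mod period)"
proof -
  have v: "v \<in> S" using assms closed_walk by blast
  then obtain b where b: "(v, root) \<in> E ^^ b" using connected root_in by blast
  have "period dvd level v + b"
    using relpow_append[OF level_walk[OF v] b] root_in period_dvd by blast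
  moreover have "period dvd level u + m + b"
    using relpow_append[OF relpow_append[OF level_walk[OF assms(1)] assms(2)] b] root_in period_dvd
    by blast
  ultimately have "[level v + b = level u + m + b] (mod period)"
    by (metis cong_0_iff cong_sym cong_trans)
  then show ?thesis by (simp only: cong_add_rcancel_nat)
qed

text \<open>
  The length of a closed walk anywhere in \<open>S\<close> is the difference of the lengths of two closed walks at
  the root: a detour through its starting vertex, with it and without it.
\<close>

lemma Gcd_return_lengths: "Gcd {m. (root, root) \<in> E ^^ m} = period"
proof (rule dvd_antisym)
  let ?L = "{m. (root, root) \<in> E ^^ m}"
  show "period dvd Gcd ?L" using period_dvd root_in by (auto intro: Gcd_greatest)
  show "Gcd ?L dvd period" unfolding period_def
  proof (rule Gcd_greatest, clarify)
    fix m u assume u: "u \<in> S" "(u, u) \<in> E ^^ m"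
    obtain b where b: "(u, root) \<in> E ^^ b" using connected u root_in by blast
    have "level u + b \<in> ?L" using relpow_append level_walk u b by fast
    moreover have "level u + b + m \<in> ?L"
      using relpow_append[OF relpow_append[OF level_walk[OF u(1)] u(2)] b]
      by (simp add: ac_simps)
    ultimately have "Gcd ?L dvd level u + b" "Gcd ?L dvd level u + b + m"
      by (auto intro: Gcd_dvd)
    then show "Gcd ?L dvd m" by (simp add: dvd_add_right_iff)
  qed
qed

text \<open>
  The walk goes from \<open>u\<close> to the root, stays there for a return length, and goes on to \<open>v\<close>. The two
  outer pieces have bounded length, so the return length is large, and it is a multiple of the period
  because of the congruence.
\<close>

lemma eventually_walk:
  "\<exists>N. \<forall>u\<in>S. \<forall>v\<in>S. \<forall>m\<ge>N. [level v = level u + m] (mod period) \<longrightarrow> (u, v) \<in> E ^^ m"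
proof -
  let ?L = "{m. (root, root) \<in> E ^^ m}"
  obtain l where "l > 0" "l \<in> ?L" using positive_closed_walk root_in by blast
  then obtain N where N: "\<And>n. n \<ge> N \<Longrightarrow> period dvd n \<Longrightarrow> n \<in> ?L"
    using additive_set_eventually_multiples[of ?L l] relpow_append
    unfolding Gcd_return_lengths by fastforce
  have "\<forall>u\<in>S. \<exists>m. (u, root) \<in> E ^^ m" using connected root_in by blast
  from bchoice[OF this] obtain home where home: "\<And>u. u \<in> S \<Longrightarrow> (u, root) \<in> E ^^ home u"
    by blast
  define B where "B = Max (home ` S) + Max (level ` S)"
  have B: "home u + level v \<le> B" if "u \<in> S" "v \<in> S" for u v
    unfolding B_def using finite_S that by (intro add_mono) auto
  have "(u, v) \<in> E ^^ m"
    if uv: "u \<in> S" "v \<in> S" and m: "m \<ge> N + B" and c: "[level v = level u + m] (mod period)" for u v m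
  proof -
    define n where "n = m - (home u + level v)"
    have n: "m = home u + n + level v" "n \<ge> N" using B[OF uv] m by (auto simp: n_def)
    have "period dvd level u + home u"
      using relpow_append[OF level_walk home] uv root_in period_dvd by blast
    moreover have "[0 + level v = (level u + home u + n) + level v] (mod period)"
      using c n(1) by (simp add: ac_simps)
    then have "period dvd level u + home u + n"
      unfolding cong_add_rcancel_nat by (simp add: cong_0_iff cong_sym_eq[of 0])
    ultimately have "period dvd n" by (simp add: dvd_add_right_iff)
    then have "(root, root) \<in> E ^^ n" using N n(2) by blast
    then show ?thesis unfolding n(1)
      using relpow_append[OF relpow_append[OF home[OF uv(1)]] level_walk[OF uv(2)]] by blast
  qed
  then show ?thesis by blast
qed

text \<open>
  A residue \<open>i\<close> is a phase of \<open>v\<close> if \<open>v\<close> can behave like a vertex of level \<open>i\<close>: some walk of length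
  \<open>m\<close> ends in \<open>S\<close> at a vertex of level congruent to \<open>i + m\<close>. The residue does not change when this walk is
  prolonged, which makes the set independent of the time of arrival.
\<close>

definition phases :: "'a \<Rightarrow> nat set" where
  "phases v = {i. i < period \<and> (\<exists>m. \<exists>x\<in>S. (v, x) \<in> E ^^ m \<and> [i + m = level x] (mod period))}"

lemma phase_of_walk:
  assumes "(v, x) \<in> E ^^ m" "x \<in> S"
  obtains i where "i \<in> phases v" "[i + m = level x] (mod period)"
proof -
  \<comment> \<open>The summand \<open>(period - 1) * m\<close> stands for \<open>- m\<close> modulo the period.\<close>
  define j where "j = level x + (period - 1) * m"
  have "j + m = level x + period * m"
    using period_pos unfolding j_def by (cases period) auto
  then have "[j mod period + m = level x] (mod period)"
    by (simp add: cong_def mod_add_left_eq)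
  then show ?thesis using that[of "j mod period"] assms period_pos
    by (auto simp: phases_def)
qed

lemma phases_subset: "phases v \<subseteq> {..<period}"
  by (auto simp: phases_def)

lemma phases_singleton:
  assumes "u \<in> S"
  shows "phases u = {level u mod period}"
proof
  show "phases u \<subseteq> {level u mod period}"
  proof
    fix i assume "i \<in> phases u"
    then obtain m x where i: "i < period" and x: "(u, x) \<in> E ^^ m" "[i + m = level x] (mod period)"
      by (auto simp: phases_def)
    have "[i + m = level u + m] (mod period)"
      using x(2) level_walk_cong[OF assms x(1)] cong_trans by blast
    then have "[i = level u] (mod period)" by (simp only: cong_add_rcancel_nat)
    then show "i \<in> {level u mod period}" using i by (simp add: cong_def)
  qed
  show "{level u mod period} \<subseteq> phases u"
    using assms period_pos by (auto simp: phases_def intro!: exI[of _ 0] bexI[of _ u])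
qed

text \<open>
  Prolonging both walks by the same walk into \<open>S\<close> makes them arrive together in \<open>S\<close>.
\<close>

lemma phases_meet_if_common_target:
  assumes "(u, z) \<in> E ^^ m" "(v, z) \<in> E ^^ m" "(z, x) \<in> E ^^ l" "x \<in> S"
  shows "phases u \<inter> phases v \<noteq> {}"
proof -
  obtain i where i: "i < period" "[i + (m + l) = level x] (mod period)"
    using phase_of_walk[OF relpow_append[OF assms(1,3)] assms(4)] phases_subset by blast
  then have "i \<in> phases u" "i \<in> phases v"
    using relpow_append[OF assms(1,3)] relpow_append[OF assms(2,3)] assms(4)
    by (auto simp: phases_def)
  then show ?thesis by blast
qed

text \<open>
  After entering \<open>S\<close> with the same phase, the two walks are at each later time in the same class.
  Any walk of one of them can then be matched by the other once enough time is left.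
\<close>

lemma eventually_common_target:
  assumes "phases u \<inter> phases v \<noteq> {}"
  shows "\<forall>\<^sub>F m in sequentially. \<exists>z. (u, z) \<in> E ^^ m \<and> (v, z) \<in> E ^^ m"
proof -
  from assms obtain i a b x y where
    x: "x \<in> S" "(u, x) \<in> E ^^ a" "[i + a = level x] (mod period)" and
    y: "y \<in> S" "(v, y) \<in> E ^^ b" "[i + b = level y] (mod period)"
    by (auto simp: phases_def)
  obtain N where N: "\<And>y z m. y \<in> S \<Longrightarrow> z \<in> S \<Longrightarrow> m \<ge> N \<Longrightarrow>
      [level z = level y + m] (mod period) \<Longrightarrow> (y, z) \<in> E ^^ m"
    using eventually_walk by blast
  have "\<exists>z. (u, z) \<in> E ^^ m \<and> (v, z) \<in> E ^^ m" if m: "m \<ge> N + a + b" for m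
  proof -
    obtain z where z: "z \<in> S" "(x, z) \<in> E ^^ (m - a)" using walk_exists x(1) by blast
    have "[level z = level x + (m - a)] (mod period)"
      using level_walk_cong[OF x(1) z(2)] .
    also have "[level x + (m - a) = (i + a) + (m - a)] (mod period)"
      using x(3) by (auto intro: cong_add cong_sym)
    also have "(i + a) + (m - a) = (i + b) + (m - b)" using m by simp
    also have "[(i + b) + (m - b) = level y + (m - b)] (mod period)"
      using y(3) by (auto intro: cong_add)
    finally have "(y, z) \<in> E ^^ (m - b)" using N y(1) z(1) m by simp
    then show ?thesis
      using relpow_append[OF x(2) z(2)] relpow_append[OF y(2)] m by fastforce
  qed
  then show ?thesis unfolding eventually_sequentially by blast
qed

end


section \<open>Phase sets in a multipartite tournament\<close>

locale partite_closed_strong_set = closed_strong_set +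
  fixes X :: "'a set" and part :: "'a \<Rightarrow> nat"
  assumes finite_X: "finite X" and S_subset: "S \<subseteq> X" and E_subset: "E \<subseteq> X \<times> X"
    and adjacent_iff: "u \<in> X \<Longrightarrow> v \<in> X \<Longrightarrow> part u \<noteq> part v \<longleftrightarrow> (u, v) \<in> E \<or> (v, u) \<in> E"
begin

lemma arc_into_S:
  assumes "v \<in> X - S" "x \<in> S" "part v \<noteq> part x"
  shows "(v, x) \<in> E"
proof -
  have "v \<in> X" "x \<in> X" using assms S_subset by auto
  then have "(v, x) \<in> E \<or> (x, v) \<in> E" using adjacent_iff assms(3) by simp
  moreover have "(x, v) \<notin> E" using closed assms by auto
  ultimately show ?thesis by simp
qed

lemma arc_parts:
  assumes "(u, v) \<in> E"
  shows "part u \<noteq> part v"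
proof -
  have "u \<in> X" "v \<in> X" using assms E_subset by auto
  then show ?thesis using adjacent_iff assms by simp
qed

lemma reaches_S:
  assumes "v \<in> X"
  obtains m x where "(v, x) \<in> E ^^ m" "x \<in> S"
proof (cases "v \<in> S")
  case True
  then show ?thesis using that[of v 0] by simp
next
  case False
  obtain x where x: "(root, x) \<in> E" "x \<in> S" using successor closed root_in by blast
  have "part v \<noteq> part root \<or> part v \<noteq> part x" using arc_parts[OF x(1)] by metis
  then have "(v, root) \<in> E \<or> (v, x) \<in> E" using arc_into_S False assms root_in x by blast
  then show ?thesis using that[of _ 1] root_in x by auto
qed

lemma phases_nonempty: "v \<in> X \<Longrightarrow> phases v \<noteq> {}"
  by (metis reaches_S phase_of_walk empty_iff)

lemma eventually_common_target_iff:
  "\<forall>\<^sub>F m in sequentially. \<forall>u\<in>X. \<forall>v\<in>X.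
     (\<exists>z. (u, z) \<in> E ^^ m \<and> (v, z) \<in> E ^^ m) \<longleftrightarrow> phases u \<inter> phases v \<noteq> {}"
proof (intro eventually_ball_finite finite_X ballI)
  fix u v assume uv: "u \<in> X" "v \<in> X"
  have X: "z \<in> X" if "(u, z) \<in> E ^^ m" for z m
    using that uv(1) E_subset by (cases m) auto
  have meet: "phases u \<inter> phases v \<noteq> {}" if "(u, z) \<in> E ^^ m" "(v, z) \<in> E ^^ m" for z m
    using reaches_S[OF X[OF that(1)]] phases_meet_if_common_target that by metis
  show "\<forall>\<^sub>F m in sequentially.
      (\<exists>z. (u, z) \<in> E ^^ m \<and> (v, z) \<in> E ^^ m) \<longleftrightarrow> phases u \<inter> phases v \<noteq> {}"
  proof (cases "phases u \<inter> phases v = {}")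
    case True
    then show ?thesis using meet by (intro always_eventually) blast
  next
    case False
    with eventually_common_target[OF this] show ?thesis by simp
  qed
qed

text \<open>
  An arc between the ends of the walk would go forward, which forces \<open>m = 1\<close>, or backward and close the
  walk to a cycle of length \<open>m + 1\<close>, each modulo the period.
\<close>

lemma same_part:
  assumes "u \<in> S" "(u, v) \<in> E ^^ m"
    and "\<not> [m = 1] (mod period)" "\<not> [m + 1 = 0] (mod period)"
  shows "part u = part v"
proof (rule ccontr)
  assume ne: "part u \<noteq> part v"
  have v: "v \<in> S" using closed_walk assms by blast
  have c: "[level v = level u + m] (mod period)" using level_walk_cong assms by blast
  from ne consider "(u, v) \<in> E" | "(v, u) \<in> E" using adjacent_iff S_subset assms(1) v by blast
  then show False
  proof cases
    case 1
    then have "[level v = level u + 1] (mod period)" using level_walk_cong[of u v 1] assms by simp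
    then have "[level u + m = level u + 1] (mod period)" using c cong_sym cong_trans by blast
    then show False using assms(3) by (simp only: cong_add_lcancel_nat)
  next
    case 2
    then have "(u, u) \<in> E ^^ (m + 1)" using assms(2) by auto
    then show False using period_dvd[OF assms(1)] assms(4) by (simp add: cong_0_iff)
  qed
qed

text \<open>
  For a walk of length \<open>3\<close> from the root, the vertices at times \<open>2\<close> and \<open>3\<close> would both lie in the
  partite set of the root, since neither \<open>2\<close> nor \<open>3\<close> is congruent to \<open>1\<close> or \<open>- 1\<close> modulo a
  period of at least \<open>5\<close>. But these two vertices are adjacent.
\<close>

lemma period_le_4: "period \<le> 4"
proof (rule ccontr)
  assume p: "\<not> period \<le> 4"
  obtain x y where x: "(root, x) \<in> E ^^ 2" "x \<in> S" and y: "(x, y) \<in> E"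
    using walk_exists[OF root_in, of 2] successor by blast
  have y3: "(root, y) \<in> E ^^ 3" using relpow_Suc_I[OF x(1) y] by (simp add: eval_nat_numeral)
  have "part root = part x"
    using p by (intro same_part[OF root_in x(1)]) (auto simp: cong_def)
  moreover have "part root = part y"
    using p by (intro same_part[OF root_in y3]) (auto simp: cong_def)
  ultimately show False using arc_parts[OF y] by simp
qed

lemma walk_entering_S:
  assumes "(v, x) \<in> E ^^ m" "v \<notin> S" "x \<in> S"
  obtains l n y w where "m = l + 1 + n" "(v, y) \<in> E ^^ l" "y \<notin> S" "(y, w) \<in> E" "w \<in> S" "(w, x) \<in> E ^^ n"
proof -
  have "\<exists>l n y w. m = l + 1 + n \<and> (v, y) \<in> E ^^ l \<and> y \<notin> S \<and> (y, w) \<in> E \<and> w \<in> S \<and> (w, x) \<in> E ^^ n"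
    using assms
  proof (induction m arbitrary: v)
    case 0
    then show ?case by auto
  next
    case (Suc m)
    from relpow_Suc_D2[OF Suc.prems(1)] obtain w where w: "(v, w) \<in> E" "(w, x) \<in> E ^^ m" by blast
    show ?case
    proof (cases "w \<in> S")
      case True
      then show ?thesis using Suc.prems w
        by (intro exI[of _ 0] exI[of _ m] exI[of _ v] exI[of _ w]) auto
    next
      case False
      from Suc.IH[OF w(2) False Suc.prems(3)] obtain l n y z where
        "m = l + 1 + n" "(w, y) \<in> E ^^ l" "y \<notin> S" "(y, z) \<in> E" "z \<in> S" "(z, x) \<in> E ^^ n" by blast
      then show ?thesis using relpow_Suc_I2[OF w(1)]
        by (intro exI[of _ "Suc l"] exI[of _ n] exI[of _ y] exI[of _ z]) auto
    qed
  qed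
  then show ?thesis using that by blast
qed

text \<open>
  The arc by which a walk enters \<open>S\<close> can be redirected to the opposite class, which lies in the same
  partite set; this changes the phase by \<open>2\<close>.
\<close>

lemma phases_shift_2:
  assumes p: "period = 4" and v: "v \<notin> S" and i: "i \<in> phases v"
  shows "(i + 2) mod 4 \<in> phases v"
proof -
  from i obtain m x where x: "x \<in> S" "(v, x) \<in> E ^^ m" "[i + m = level x] (mod 4)"
    by (auto simp: phases_def p)
  obtain l n y w where w: "m = l + 1 + n" "(v, y) \<in> E ^^ l" "y \<notin> S" "(y, w) \<in> E" "w \<in> S" "(w, x) \<in> E ^^ n"
    using walk_entering_S[OF x(2) v x(1)] by blast
  have "[level w + n = i + m] (mod 4)"
    using level_walk_cong[OF w(5,6)] x(3) cong_sym cong_trans unfolding p by blast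
  then have "[level w + n = (i + l + 1) + n] (mod 4)" unfolding w(1) by (simp add: ac_simps)
  then have c: "[level w = i + l + 1] (mod 4)" by (simp only: cong_add_rcancel_nat)
  obtain z where z: "(w, z) \<in> E ^^ 2" "z \<in> S" using walk_exists w(5) by blast
  have "part w = part z"
    by (rule same_part[OF w(5) z(1)]) (auto simp: cong_def p)
  then have "part y \<noteq> part z" using arc_parts[OF w(4)] by simp
  then have "(y, z) \<in> E" using arc_into_S[of y z] w(3,4) E_subset z(2) by blast
  then have vz: "(v, z) \<in> E ^^ (l + 1)" using w(2) by auto
  have "[level z = level w + 2] (mod 4)" using level_walk_cong[OF w(5) z(1)] p by simp
  also have "[level w + 2 = i + l + 1 + 2] (mod 4)" using c by (simp only: cong_add_rcancel_nat)
  also have "i + l + 1 + 2 = (i + 2) + (l + 1)" by simp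
  finally have "[(i + 2) mod 4 + (l + 1) = level z] (mod 4)"
    unfolding cong_def mod_add_left_eq by (rule sym)
  moreover have "(i + 2) mod 4 < 4" by simp
  ultimately show ?thesis using vz z(2) unfolding phases_def p by blast
qed

lemma phases_period_4:
  assumes "period = 4" "v \<in> X"
  shows "phases v \<in> {{0}, {1}, {2}, {3}, {0, 2}, {1, 3}, {0, 1, 2, 3}}"
proof (cases "v \<in> S")
  case True
  then obtain n where n: "phases v = {n}" "n < 4"
    using phases_singleton assms(1) mod_less_divisor[of 4] by (metis zero_less_numeral)
  from n(2) have "n = 0 \<or> n = 1 \<or> n = 2 \<or> n = 3" by linarith
  then show ?thesis unfolding n(1) by blast
next
  case False
  define P where "P = phases v"
  have sub: "P \<subseteq> {0, 1, 2, 3}" using phases_subset[of v] assms(1) by (auto simp: P_def)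
  have ne: "P \<noteq> {}" using phases_nonempty assms(2) by (simp add: P_def)
  have shift: "(i + 2) mod 4 \<in> P" if "i \<in> P" for i
    using phases_shift_2[OF assms(1) False] that by (simp add: P_def)
  have "0 \<in> P \<longleftrightarrow> 2 \<in> P" "1 \<in> P \<longleftrightarrow> 3 \<in> P"
    using shift[of 0] shift[of 1] shift[of 2] shift[of 3]
    by (auto simp del: add_2_eq_Suc add_2_eq_Suc')
  then have "P = {} \<or> P = {0, 2} \<or> P = {1, 3} \<or> P = {0, 1, 2, 3}"
    using sub by (cases "0 \<in> P"; cases "1 \<in> P") blast+
  with ne show ?thesis unfolding P_def by blast
qed

end


section \<open>Intersection graphs\<close>

definition intersection_graph :: "'a set \<Rightarrow> ('a \<Rightarrow> 'i set) \<Rightarrow> 'a pair_pre_digraph" where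
  "intersection_graph X P =
     \<lparr> pverts = X, parcs = {(u, v). u \<in> X \<and> v \<in> X \<and> u \<noteq> v \<and> P u \<inter> P v \<noteq> {}} \<rparr>"

lemma intersection_graph_graph:
  assumes "finite X"
  shows "graph (with_proj (intersection_graph X P))"
proof -
  have "finite (parcs (intersection_graph X P))"
    by (rule finite_subset[of _ "X \<times> X"]) (auto simp: intersection_graph_def assms)
  then interpret pair_graph "intersection_graph X P"
    using assms by unfold_locales (auto simp: intersection_graph_def symmetric_def intro!: symI)
  show ?thesis by unfold_locales
qed

text \<open>
  Vertices with the same nonempty set form a clique, and two such cliques are completely joined or not
  joined at all, according to whether their sets meet.
\<close>

lemma intersection_graph_clique_partition:
  assumes fin: "finite X"
    and cover: "P ` X \<subseteq> f ` {1..r}" and inj: "inj_on f {1..r}"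
    and ne: "{} \<notin> f ` {1..r}"
    and J: "\<forall>i\<in>{1..r}. \<forall>j\<in>{1..r}. i \<noteq> j \<longrightarrow> ({i, j} \<in> J \<longleftrightarrow> f i \<inter> f j \<noteq> {})"
  shows "clique_partition_form r J (with_proj (intersection_graph X P))"
  unfolding clique_partition_form_def
proof (intro conjI exI)
  let ?G = "intersection_graph X P"
  let ?W = "\<lambda>i. {v \<in> X. P v = f i}"
  show "graph (with_proj ?G)" using fin by (rule intersection_graph_graph)
  show "disjoint_family_on ?W {1..r}"
    unfolding disjoint_family_on_def
  proof (intro ballI impI equals0I)
    fix i j v assume ij: "i \<in> {1..r}" "j \<in> {1..r}" "i \<noteq> j" and v: "v \<in> ?W i \<inter> ?W j"
    from v have "P v = f i" "P v = f j" by blast+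
    then have "f i = f j" by metis
    then show False using inj_onD[OF inj _ ij(1,2)] ij(3) by blast
  qed
  show "(\<Union>i\<in>{1..r}. ?W i) = verts (with_proj ?G)"
    using cover by (auto simp: intersection_graph_def)
  show "\<forall>i\<in>{1..r}. complete_digraph (card (?W i)) (with_proj ?G \<restriction> ?W i)"
  proof
    fix i assume i: "i \<in> {1..r}"
    let ?H = "\<lparr> pverts = ?W i, parcs = {(u, v). u \<in> ?W i \<and> v \<in> ?W i \<and> u \<noteq> v} \<rparr>"
    have "f i \<noteq> {}" using ne i by (metis image_eqI)
    then have "with_proj ?G \<restriction> ?W i = with_proj ?H"
      by (auto simp: induce_subgraph_def with_proj_def intersection_graph_def)
    moreover have "complete_digraph (card (?W i)) (with_proj ?H)"
      using fin by (auto simp: complete_digraph_pair_def)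
    ultimately show "complete_digraph (card (?W i)) (with_proj ?G \<restriction> ?W i)" by simp
  qed
  show "\<forall>i\<in>{1..r}. \<forall>j\<in>{1..r}. i \<noteq> j \<longrightarrow>
      (if {i, j} \<in> J then \<forall>u\<in>?W i. \<forall>v\<in>?W j. u \<rightarrow>\<^bsub>with_proj ?G\<^esub> v
       else \<forall>u\<in>?W i. \<forall>v\<in>?W j. \<not> u \<rightarrow>\<^bsub>with_proj ?G\<^esub> v)"
  proof (intro ballI impI)
    fix i j assume "i \<in> {1..r}" "j \<in> {1..r}" "i \<noteq> j"
    then have "f i \<noteq> f j" "{i, j} \<in> J \<longleftrightarrow> f i \<inter> f j \<noteq> {}"
      using inj_onD[OF inj, of i j] J by blast+
    then show "if {i, j} \<in> J then \<forall>u\<in>?W i. \<forall>v\<in>?W j. u \<rightarrow>\<^bsub>with_proj ?G\<^esub> v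
       else \<forall>u\<in>?W i. \<forall>v\<in>?W j. \<not> u \<rightarrow>\<^bsub>with_proj ?G\<^esub> v"
      by (auto simp: intersection_graph_def)
  qed
qed

lemma intersection_graph_complete:
  assumes "finite X" "\<And>u v. u \<in> X \<Longrightarrow> v \<in> X \<Longrightarrow> P u \<inter> P v \<noteq> {}"
  shows "complete_digraph (card X) (with_proj (intersection_graph X P))"
  using assms by (auto simp: complete_digraph_pair_def intersection_graph_def)

lemma interval_7: "{1..7::nat} = {1, 2, 3, 4, 5, 6, 7}" "{2..7::nat} = {2, 3, 4, 5, 6, 7}"
  by auto

lemma intersection_graph_form_G1:
  assumes "finite X" "\<And>v. v \<in> X \<Longrightarrow> P v \<in> {{0::nat}, {1}, {0, 1}}"
  shows "form_G1 (with_proj (intersection_graph X P))"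
  unfolding form_G1_def
proof (rule intersection_graph_clique_partition[OF assms(1)])
  \<comment> \<open>The indices start at \<open>1\<close>, so the entry at position \<open>0\<close> is a dummy, here and below.\<close>
  let ?f = "(!) [{}, {0::nat, 1}, {0}, {1}]"
  have 3: "{1..3::nat} = {1, 2, 3}" by auto
  have im: "?f ` {1..3} = {{0, 1}, {0}, {1}}" unfolding 3 by simp
  show "P ` X \<subseteq> ?f ` {1..3}" unfolding im using assms(2) by blast
  show "inj_on ?f {1..3}" unfolding 3 by simp
  show "{} \<notin> ?f ` {1..3}" unfolding im by simp
  show "\<forall>i\<in>{1..3}. \<forall>j\<in>{1..3}. i \<noteq> j \<longrightarrow>
      ({i, j} \<in> {{1, 2}, {1, 3}} \<longleftrightarrow> ?f i \<inter> ?f j \<noteq> {})"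
    unfolding 3 by (simp add: doubleton_eq_iff)
qed

text \<open>
  The clique with index \<open>1\<close> belongs to the full set, those with indices \<open>2\<close> and \<open>3\<close> to the two pairs of
  opposite residues, and the others to the singletons.
\<close>

lemma intersection_graph_form_G2:
  assumes "finite X"
    and "\<And>v. v \<in> X \<Longrightarrow> P v \<in> {{0::nat}, {1}, {2}, {3}, {0, 2}, {1, 3}, {0, 1, 2, 3}}"
  shows "form_G2 (with_proj (intersection_graph X P))"
  unfolding form_G2_def
proof (rule intersection_graph_clique_partition[OF assms(1)])
  let ?f = "(!) [{}, {0::nat, 1, 2, 3}, {0, 2}, {1, 3}, {0}, {2}, {1}, {3}]"
  have im: "?f ` {1..7} = {{0, 1, 2, 3}, {0, 2}, {1, 3}, {0}, {2}, {1}, {3}}"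
    unfolding interval_7 by simp
  show "P ` X \<subseteq> ?f ` {1..7}" unfolding im using assms(2) by blast
  show "inj_on ?f {1..7}" unfolding interval_7 by (simp add: set_eq_subset)
  show "{} \<notin> ?f ` {1..7}" unfolding im by simp
  show "\<forall>i\<in>{1..7}. \<forall>j\<in>{1..7}. i \<noteq> j \<longrightarrow> ({i, j} \<in> {{1, i} |i. i \<in> {2..7}} \<union> {{2, 4}, {2, 5}, {3, 6}, {3, 7}} \<longleftrightarrow>
      ?f i \<inter> ?f j \<noteq> {})"
    unfolding interval_7 Setcompr_eq_image
    by (simp add: doubleton_eq_iff)
qed

text \<open>
  The clique with index \<open>1\<close> belongs to the full set, those with indices \<open>2\<close> to \<open>4\<close> to the three pairs,
  and the others to the singletons; the two singletons joined to a pair are its members.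
\<close>

lemma intersection_graph_form_G3:
  assumes "finite X"
    and "\<And>v. v \<in> X \<Longrightarrow> P v \<in> {{0::nat}, {1}, {2}, {0, 1}, {0, 2}, {1, 2}, {0, 1, 2}}"
  shows "form_G3 (with_proj (intersection_graph X P))"
  unfolding form_G3_def
proof (rule intersection_graph_clique_partition[OF assms(1)])
  let ?f = "(!) [{}, {0::nat, 1, 2}, {0, 1}, {0, 2}, {1, 2}, {0}, {1}, {2}]"
  have im: "?f ` {1..7} = {{0, 1, 2}, {0, 1}, {0, 2}, {1, 2}, {0}, {1}, {2}}"
    unfolding interval_7 by simp
  show "P ` X \<subseteq> ?f ` {1..7}" unfolding im using assms(2) by blast
  show "inj_on ?f {1..7}" unfolding interval_7 by (simp add: set_eq_subset)
  show "{} \<notin> ?f ` {1..7}" unfolding im by simp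
  show "\<forall>i\<in>{1..7}. \<forall>j\<in>{1..7}. i \<noteq> j \<longrightarrow> ({i, j} \<in> {{1, i} |i. i \<in> {2..7}} \<union> {{2, 3}, {2, 4}, {3, 4}} \<union> {{2, 5}, {2, 6}} \<union>
      {{3, 5}, {3, 7}} \<union> {{4, 6}, {4, 7}} \<longleftrightarrow> ?f i \<inter> ?f j \<noteq> {})"
    unfolding interval_7 Setcompr_eq_image
    by (simp add: doubleton_eq_iff)
qed


section \<open>The last strong component\<close>

lemma (in wf_digraph) awalk_relpow:
  "(\<exists>p. awalk u p v \<and> length p = m) \<longleftrightarrow> u \<in> verts G \<and> (u, v) \<in> arcs_ends G ^^ m"
proof (induction m arbitrary: u)
  case 0
  then show ?case by (auto simp: awalk_Nil_iff)
next
  case (Suc m)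
  have "(\<exists>p. awalk u p v \<and> length p = Suc m) \<longleftrightarrow> (\<exists>e p. awalk u (e # p) v \<and> length p = m)"
    by (metis length_Suc_conv)
  also have "\<dots> \<longleftrightarrow>
      (\<exists>e\<in>arcs G. u = tail G e \<and> (\<exists>p. awalk (head G e) p v \<and> length p = m))"
    by (auto simp: awalk_Cons_iff)
  also have "\<dots> \<longleftrightarrow> (\<exists>e\<in>arcs G. u = tail G e \<and> (head G e, v) \<in> arcs_ends G ^^ m)"
    by (simp add: Suc.IH cong: conj_cong)
  also have "\<dots> \<longleftrightarrow> u \<in> verts G \<and> (u, v) \<in> arcs_ends G ^^ Suc m"
    unfolding relpow_commute[symmetric] relpow.simps(2)
    by (auto simp: arcs_ends_conv relcomp_unfold relpow_commute)
  finally show ?case .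
qed

lemma digraph_iso_refl_pair:
  assumes "wf_digraph (with_proj G)"
  shows "digraph_iso (with_proj G) (with_proj G)"
  unfolding digraph_iso_def
  by (rule exI[of _ "\<lparr>iso_verts = id, iso_arcs = id, iso_head = snd, iso_tail = fst\<rparr>"])
    (use assms in \<open>auto simp: pre_digraph.digraph_isomorphism_def app_iso_def with_proj_def\<close>)

lemma step_competition_graph_relpow:
  assumes "wf_digraph D"
  shows "step_competition_graph m D =
    \<lparr> pverts = verts D,
      parcs = {(u, v). u \<in> verts D \<and> v \<in> verts D \<and> u \<noteq> v \<and>
        (\<exists>z. (u, z) \<in> arcs_ends D ^^ m \<and> (v, z) \<in> arcs_ends D ^^ m)} \<rparr>"
proof -
  interpret wf_digraph D by fact
  have "(\<exists>z p q. awalk u p z \<and> length p = m \<and> awalk v q z \<and> length q = m) \<longleftrightarrow>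
      (\<exists>z. (\<exists>p. awalk u p z \<and> length p = m) \<and> (\<exists>q. awalk v q z \<and> length q = m))" for u v
    by blast
  then show ?thesis unfolding step_competition_graph_def awalk_relpow by auto
qed

text \<open>
  The end of the arc lies in some component, and an earlier one is excluded by the ordering.
\<close>

lemma last_component_closed:
  assumes D: "wf_digraph D" and ord: "ordered_strong_components s Q D" and s: "s \<ge> 1"
    and uv: "u \<rightarrow>\<^bsub>D\<^esub> v" "u \<in> verts (Q s)"
  shows "v \<in> verts (Q s)"
proof -
  interpret wf_digraph D by fact
  have "v \<in> verts D" using uv(1) by (auto simp: arcs_ends_conv)
  then have "D \<restriction> scc_of v \<in> sccs" "v \<in> scc_of v"
    using scc_of_in_sccs_verts in_sccs_verts_conv by (auto simp: scc_of_def)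
  then obtain j where "j \<in> {1..s}" "v \<in> verts (Q j)"
    using ord unfolding ordered_strong_components_def bij_betw_def
    by (metis imageE induce_subgraph_verts)
  then show ?thesis
    using ord uv s unfolding ordered_strong_components_def
    by (metis atLeastAtMost_iff le_neq_implies_less le_refl)
qed

lemma arcs_ends_induced:
  assumes "induced_subgraph H G"
  shows "arcs_ends H = arcs_ends G \<inter> verts H \<times> verts H"
proof -
  have "tail H = tail G" "head H = head G"
    using assms by (auto simp: induced_subgraph_def subgraph_def compatible_def)
  then show ?thesis using assms by (auto simp: induced_subgraph_def arcs_ends_conv)
qed

lemma relpow_restrict_closed:
  assumes "\<And>u v. (u, v) \<in> E \<Longrightarrow> u \<in> S \<Longrightarrow> v \<in> S" "u \<in> S"
  shows "(u, v) \<in> (E \<inter> S \<times> S) ^^ m \<longleftrightarrow> (u, v) \<in> E ^^ m"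
proof -
  have "(u, v) \<in> (E \<inter> S \<times> S) ^^ m \<and> v \<in> S \<longleftrightarrow> (u, v) \<in> E ^^ m"
    by (induction m arbitrary: v) (use assms in \<open>auto 4 4\<close>)
  moreover have "v \<in> S" if "(u, v) \<in> (E \<inter> S \<times> S) ^^ m"
    using that assms(2) by (cases m) auto
  ultimately show ?thesis by blast
qed

text \<open>
  Since the last component is closed, walks that start in it are the same in \<open>D\<close> and in the component,
  so its index of imprimitivity can be computed in \<open>D\<close>. Being nontrivial, it has a first arc on a walk from
  any vertex to another one.
\<close>

lemma last_component_walks:
  assumes D: "digraph D" and ord: "ordered_strong_components s Q D" and s: "s \<ge> 1"
    and nontriv: "\<not> trivial_component (Q s)"
  shows "closed_strong_set (arcs_ends D) (verts (Q s))" (is ?closed)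
    and "verts (Q s) \<subseteq> verts D"
    and "imprimitivity_index (Q s) = closed_strong_set.period (arcs_ends D) (verts (Q s))" (is ?index)
proof -
  interpret digraph D by fact
  let ?E = "arcs_ends D" and ?S = "verts (Q s)"
  have "Q s \<in> sccs" using ord s by (auto simp: ordered_strong_components_def bij_betw_def)
  then have ind: "induced_subgraph (Q s) D" and str: "strongly_connected (Q s)"
    by (auto simp: sccs_def)
  show sub: "?S \<subseteq> verts D" using ind by (auto simp: induced_subgraph_def subgraph_def)
  interpret H: wf_digraph "Q s" using ind by (auto simp: induced_subgraph_def subgraph_def)
  have cl: "v \<in> ?S" if "(u, v) \<in> ?E" "u \<in> ?S" for u v
    using last_component_closed[OF wf_digraph ord s that] .
  have walks: "(\<exists>p. H.awalk u p v \<and> length p = m) \<longleftrightarrow> u \<in> ?S \<and> (u, v) \<in> ?E ^^ m" for u v m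
    using relpow_restrict_closed[of ?E ?S u v m] cl
    unfolding H.awalk_relpow arcs_ends_induced[OF ind] by blast
  have conn: "\<exists>m. (u, v) \<in> ?E ^^ m" if "u \<in> ?S" "v \<in> ?S" for u v
    using str that walks unfolding strongly_connected_def H.reachable_awalk by blast
  have fin: "finite ?S" using sub finite_verts by (rule finite_subset)
  have ne: "?S \<noteq> {}" using str by (auto simp: strongly_connected_def)
  have succ: "\<exists>v. (u, v) \<in> ?E" if u: "u \<in> ?S" for u
  proof -
    have "\<not> ?S \<subseteq> {u}" using nontriv ne by (auto simp: trivial_component_def subset_singleton_iff)
    then obtain v where v: "v \<in> ?S" "v \<noteq> u" by blast
    then obtain m where "(u, v) \<in> ?E ^^ m" using conn u by blast
    with v(2) obtain n where "(u, v) \<in> ?E ^^ Suc n" by (cases m) auto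
    from relpow_Suc_D2[OF this] show ?thesis by blast
  qed
  show ?closed
    by unfold_locales (use fin ne cl conn succ in auto)
  then interpret C: closed_strong_set ?E ?S .
  have "{length p |p u. H.awalk u p u \<and> p \<noteq> []} = {m. 0 < m \<and> (\<exists>u. \<exists>p. H.awalk u p u \<and> length p = m)}"
    by auto
  then show ?index unfolding imprimitivity_index_def C.period_def walks by (auto simp: Bex_def)
qed

lemma partite_tournament_part:
  assumes "partite_tournament k V D"
  obtains part :: "'a \<Rightarrow> nat" where
    "\<And>u v. u \<in> verts D \<Longrightarrow> v \<in> verts D \<Longrightarrow> part u \<noteq> part v \<longleftrightarrow> u \<rightarrow>\<^bsub>D\<^esub> v \<or> v \<rightarrow>\<^bsub>D\<^esub> u"
proof -
  have "\<exists>i. i \<in> {1..k} \<and> v \<in> V i" if "v \<in> verts D" for v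
  proof -
    have "v \<in> (\<Union>i\<in>{1..k}. V i)" using assms that by (simp add: partite_tournament_def)
    then show ?thesis by blast
  qed
  then obtain part where part: "\<And>v. v \<in> verts D \<Longrightarrow> part v \<in> {1..k} \<and> v \<in> V (part v)"
    by metis
  have "part u \<noteq> part v \<longleftrightarrow> u \<rightarrow>\<^bsub>D\<^esub> v \<or> v \<rightarrow>\<^bsub>D\<^esub> u" if "u \<in> verts D" "v \<in> verts D" for u v
    using assms part[OF that(1)] part[OF that(2)] unfolding partite_tournament_def by metis
  then show ?thesis by (rule that)
qed

theorem theorem1p2:
  fixes k s :: nat
    and D :: "('a, 'b) pre_digraph"
    and V :: "nat \<Rightarrow> 'a set"
    and Q :: "nat \<Rightarrow> ('a, 'b) pre_digraph"
  assumes "k \<ge> 2" and "s \<ge> 1"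
    and "partite_tournament k V D"
    and "ordered_strong_components s Q D"
    and "\<not> trivial_component (Q s)"
  shows "imprimitivity_index (Q s) \<in> {1, 2, 3, 4} \<and>
    (\<exists>G. graph_seq_converges (\<lambda>m. step_competition_graph m D) G \<and>
       (imprimitivity_index (Q s) = 1 \<longrightarrow>
          (\<exists>H :: 'a pair_pre_digraph. digraph_iso (with_proj G) (with_proj H) \<and>
             complete_digraph (card (verts D)) (with_proj H))) \<and>
       (imprimitivity_index (Q s) = 2 \<longrightarrow>
          (\<exists>H :: 'a pair_pre_digraph. digraph_iso (with_proj G) (with_proj H) \<and> form_G1 (with_proj H))) \<and>
       (imprimitivity_index (Q s) = 3 \<longrightarrow>
          (\<exists>H :: 'a pair_pre_digraph. digraph_iso (with_proj G) (with_proj H) \<and> form_G3 (with_proj H))) \<and>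
       (imprimitivity_index (Q s) = 4 \<longrightarrow>
          (\<exists>H :: 'a pair_pre_digraph. digraph_iso (with_proj G) (with_proj H) \<and> form_G2 (with_proj H))))"
proof -
  have D: "digraph D" using assms(3) by (simp add: partite_tournament_def)
  interpret digraph D by fact
  let ?E = "arcs_ends D" and ?S = "verts (Q s)" and ?X = "verts D"
  note comp = last_component_walks[OF D assms(4,2,5)]
  obtain part :: "'a \<Rightarrow> nat" where part:
    "\<And>u v. u \<in> ?X \<Longrightarrow> v \<in> ?X \<Longrightarrow> part u \<noteq> part v \<longleftrightarrow> u \<rightarrow>\<^bsub>D\<^esub> v \<or> v \<rightarrow>\<^bsub>D\<^esub> u"
    using partite_tournament_part[OF assms(3)] by blast
  interpret C: closed_strong_set ?E ?S by (rule comp(1))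
  interpret C: partite_closed_strong_set ?E ?S ?X part
    by unfold_locales (use comp(2) part in \<open>auto simp: arcs_ends_conv\<close>)
  note index = comp(3)
  \<comment> \<open>The limit is the intersection graph of the phase sets; each case below only identifies which
    phase sets can occur.\<close>
  let ?G = "intersection_graph ?X C.phases"
  have "\<forall>\<^sub>F m in sequentially. step_competition_graph m D = ?G"
    using C.eventually_common_target_iff
    by (rule eventually_mono)
      (auto simp: step_competition_graph_relpow[OF wf_digraph] intersection_graph_def)
  then have "graph_seq_converges (\<lambda>m. step_competition_graph m D) ?G"
    by (simp add: graph_seq_converges_def eventually_sequentially)
  moreover have "digraph_iso (with_proj ?G) (with_proj ?G)"
    using intersection_graph_graph[OF finite_verts, of C.phases]
    by (intro digraph_iso_refl_pair) (simp add: graph_def digraph_def fin_digraph_def)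
  moreover have "complete_digraph (card ?X) (with_proj ?G)" if p: "C.period = 1"
  proof (rule intersection_graph_complete)
    have "C.phases v = {0}" if "v \<in> ?X" for v
      using C.phases_nonempty[OF that] C.phases_subset[of v] p by auto
    then show "C.phases u \<inter> C.phases v \<noteq> {}" if "u \<in> ?X" "v \<in> ?X" for u v using that by simp
  qed simp
  moreover have "form_G1 (with_proj ?G)" if p: "C.period = 2"
  proof (rule intersection_graph_form_G1)
    fix v assume v: "v \<in> ?X"
    define P where "P = C.phases v"
    have "P \<noteq> {}" using C.phases_nonempty[OF v] by (simp add: P_def)
    moreover have "P \<subseteq> {0, 1}" using C.phases_subset[of v] unfolding P_def p by fastforce
    ultimately have "P \<in> {{0}, {1}, {0, 1}}" by (cases "0 \<in> P"; cases "1 \<in> P") blast+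
    then show "C.phases v \<in> {{0}, {1}, {0, 1}}" unfolding P_def .
  qed simp
  moreover have "form_G3 (with_proj ?G)" if p: "C.period = 3"
  proof (rule intersection_graph_form_G3)
    fix v assume v: "v \<in> ?X"
    define P where "P = C.phases v"
    have "P \<noteq> {}" using C.phases_nonempty[OF v] by (simp add: P_def)
    moreover have "P \<subseteq> {0, 1, 2}" using C.phases_subset[of v] unfolding P_def p by fastforce
    ultimately have "P \<in> {{0}, {1}, {2}, {0, 1}, {0, 2}, {1, 2}, {0, 1, 2}}"
      by (cases "0 \<in> P"; cases "1 \<in> P"; cases "2 \<in> P") blast+
    then show "C.phases v \<in> {{0}, {1}, {2}, {0, 1}, {0, 2}, {1, 2}, {0, 1, 2}}" unfolding P_def .
  qed simp
  moreover have "form_G2 (with_proj ?G)" if "C.period = 4"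
    using C.phases_period_4[OF that] by (intro intersection_graph_form_G2) simp_all
  moreover have "C.period \<in> {1, 2, 3, 4}"
    using C.period_pos C.period_le_4 by auto
  ultimately show ?thesis unfolding index by blast
qed

end
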